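(* Let $n\ge 6$ and $1\le k\le \lfloor n/2\rfloor$, and use the conventions $r_0(n)=2$ and $r_{\lfloor n/2\rfloor}(n)=1$. Then for every $r\in(r_k(n),r_{k-1}(n))$ the $k$-isolated cut has maximum weight among all isolated cuts: $W^n(C_k;r)\ge W^n(C_j;r)$ for all $j=1,\dots,\lfloor n/2\rfloor$.
   Context: For an integer $n\ge 2$ let $N=\binom{n}{2}$. The edges $(i,j)$, $1\le i<j\le n$, of the complete graph $K_n$ on vertex set $\{1,\dots,n\}$ are ordered lexicographically: $(1,2),(1,3),\dots,(1,n),(2,3),\dots,(n-1,n)$, so that $(i,j)$ has index $\mathrm{idx}(i,j)=(i-1)n-\binom{i}{2}+(j-i)\in\{1,\dots,N\}$. For a binary string $\mathbf{x}=(x_1,\dots,x_n)$, its cut vector $\delta(\mathbf{x})\in\{0,1\}^N$ has entry $1$ at position $\mathrm{idx}(i,j)$ iff $x_i\ne x_j$. For real $r>1$ and $\delta\in\{0,1\}^N$ set $W^n(\delta;r)=\sum_{i=1}^N \delta_i r^{N-i}$. For $1\le k\le n$, the $k$-isolated cut is $C_k=\delta(1^k0^{n-k})$ (the string of $k$ ones followed by $n-k$ zeros), corresponding to the partition $\{1,\dots,k\}\mid\{k+1,\dots,n\}$; the "isolated cuts" are the $C_j$. For $1\le k\le n-1$ define the threshold polynomial $P^{n,k}(r)=W^n(C_k;r)-W^n(C_{k+1};r)$. For $n\ge 6$ and $1\le k\le\lfloor n/2\rfloor-1$, $P^{n,k}$ has exactly one root in $(1,2)$; this root is denoted $r_k(n)$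 (the threshold at which $C_k$ and $C_{k+1}$ have equal weight). *)

theory Defs
  imports Complex_Main
begin

(* 1 <= i < j <= n; on this range both natural-number subtractions are exact. *)
definition edge_idx :: "nat \<Rightarrow> nat \<Rightarrow> nat \<Rightarrow> nat" where
  "edge_idx n i j = (i - 1) * n - (i choose 2) + (j - i)"

(* Vertices are numbered from 1, list positions from 0.  A vector in {0,1}^N is a
   function of which only the positions 1, ..., N matter. *)
definition cut_vector :: "bool list \<Rightarrow> nat \<Rightarrow> nat" where
  "cut_vector x p =
     (if \<exists>i j. 1 \<le> i \<and> i < j \<and> j \<le> length x \<and> p = edge_idx (length x) i j
               \<and> x ! (i - 1) \<noteq> x ! (j - 1)
      then 1 else 0)"

definition cut_weight :: "nat \<Rightarrow> (nat \<Rightarrow> nat) \<Rightarrow> real \<Rightarrow> real" where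
  "cut_weight n \<delta> r = (\<Sum>i = 1..n choose 2. real (\<delta> i) * r ^ ((n choose 2) - i))"

definition isolated_cut :: "nat \<Rightarrow> nat \<Rightarrow> nat \<Rightarrow> nat" where
  "isolated_cut n k = cut_vector (replicate k True @ replicate (n - k) False)"

definition threshold_poly :: "nat \<Rightarrow> nat \<Rightarrow> real \<Rightarrow> real" where
  "threshold_poly n k r =
     cut_weight n (isolated_cut n k) r - cut_weight n (isolated_cut n (k + 1)) r"

(* Meaningful for n >= 6 and k <= n div 2; the cases k = 0 and k = n div 2 are
   conventions, and in between the root in (1,2) exists and is unique. *)
definition threshold :: "nat \<Rightarrow> nat \<Rightarrow> real" where
  "threshold n k =
     (if k = 0 then 2
      else if k = n div 2 then 1
      else (THE r. 1 < r \<and> r < 2 \<and> threshold_poly n k r = 0))"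

end

theory Submission
  imports Defs
begin

text \<open>
  Edge \<open>(i, j)\<close> carries the weight exponent \<open>((n - i) choose 2) + (n - j)\<close>, so the weight of \<open>C\<^sub>k\<close>
  factors as \<open>A\<^sub>k * S\<^bsub>n-k\<^esub>\<close> with \<open>A\<^sub>k = \<Sum>i\<le>k. r ^ ((n - i) choose 2)\<close> and
  \<open>S\<^sub>m = 1 + r + \<dots> + r ^ (m - 1)\<close>.  With \<open>m = n - k - 1\<close> this gives
  \<open>P\<^sub>k = A\<^sub>k * r ^ m - r ^ (m choose 2) * S\<^sub>m\<close>.  Every exponent of the first term exceeds every
  exponent of the second one, so \<open>P\<^sub>k\<close> changes sign only once, from negative to positive.
  Moreover \<open>P\<^sub>k(r) \<ge> 0\<close> forces \<open>P\<^bsub>k+1\<^esub>(r) > 0\<close> for \<open>r > 1\<close>.  So for \<open>r\<close> between \<open>r\<^sub>k\<close> and \<open>r\<^bsub>k-1\<^esub>\<close>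
  the weights of the \<open>C\<^sub>j\<close> increase up to \<open>j = k\<close> and decrease afterwards.
\<close>

section \<open>Arithmetic of lexicographic edge positions\<close>

lemma choose_two_add:
  fixes a b :: nat
  shows "(a + b) choose 2 = (a choose 2) + (b choose 2) + a * b"
  by (induction b) (simp_all add: numeral_2_eq_2)

lemma choose_two_Suc: "Suc a choose 2 = (a choose 2) + a" for a :: nat
  by (simp add: numeral_2_eq_2)

lemma choose_two_double: "2 * (i choose 2) = i * (i - 1)" for i :: nat
proof -
  have "even (i * (i - 1))" by (cases i) auto
  then show ?thesis by (simp add: choose_two)
qed

text \<open>After \<open>(i, j)\<close> come exactly the \<open>(n - i) choose 2\<close> edges among
  later vertices and the \<open>n - j\<close> edges \<open>(i, j')\<close> with
  \<open>j' > j\<close>. Their number is the exponent of \<open>r\<close> at this edge.\<close>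

lemma edge_idx_complement:
  assumes "1 \<le> i" "i < j" "j \<le> n"
  shows "edge_idx n i j + (((n - i) choose 2) + (n - j)) = n choose 2"
proof -
  obtain d where d: "n = i + d" using assms by (metis le_add_diff_inverse less_le_trans less_imp_le)
  obtain i' where i': "i = Suc i'" using assms by (cases i) auto
  have dbl: "2 * (i choose 2) = i * i'" using choose_two_double[of i] i' by simp
  \<comment> \<open>This makes the truncated subtraction in \<open>edge_idx\<close> exact.\<close>
  have le: "i choose 2 \<le> (i - 1) * n"
    using dbl i' d by (simp add: algebra_simps)
  \<comment> \<open>Adding \<open>d\<close> completes \<open>(i - 1) * d\<close> to
    \<open>i * d\<close>; the rest is then linear in \<open>i choose 2\<close>,
    \<open>d choose 2\<close> and \<open>i * d\<close>.\<close>
  have "(i - 1) * n + d = 2 * (i choose 2) + i * d"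
    unfolding dbl using i' d by (simp add: algebra_simps)
  moreover have "n choose 2 = (i choose 2) + (d choose 2) + i * d"
    unfolding d by (rule choose_two_add)
  moreover have "(j - i) + (n - j) = d" "(n - i) choose 2 = d choose 2" using assms d by auto
  ultimately show ?thesis
    using le unfolding edge_idx_def by linarith
qed

text \<open>For \<open>b < a\<close> the sum lies between \<open>a choose 2\<close> and
  \<open>(a + 1) choose 2\<close>, the upper end excluded; these intervals are disjoint for
  different \<open>a\<close>.\<close>

lemma choose_two_plus_eqD:
  fixes a b c d :: nat
  assumes "b < a" "d < c" "(a choose 2) + b = (c choose 2) + d"
  shows "a = c \<and> b = d"
proof -
  have less: "(a choose 2) + b < c choose 2" if "b < a" "a < c" for a b c :: nat
  proof -
    have "(a choose 2) + b < (a + 1) choose 2" using that by (simp add: choose_two_Suc)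
    also have "\<dots> \<le> c choose 2" using that by (intro binomial_right_mono) simp
    finally show ?thesis .
  qed
  have "a = c" using less[of b a c] less[of d c a] assms by (cases a c rule: linorder_cases) auto
  then show ?thesis using assms by simp
qed

lemma edge_idx_inj:
  assumes "1 \<le> i" "i < j" "j \<le> n" "1 \<le> i'" "i' < j'" "j' \<le> n"
    and "edge_idx n i j = edge_idx n i' j'"
  shows "i = i' \<and> j = j'"
proof -
  have "((n - i) choose 2) + (n - j) = ((n - i') choose 2) + (n - j')"
    using edge_idx_complement[of i j n] edge_idx_complement[of i' j' n] assms by linarith
  then have "n - i = n - i' \<and> n - j = n - j'"
    using assms by (intro choose_two_plus_eqD) auto
  then show ?thesis using assms by auto
qed

lemma edge_idx_bounds:
  assumes "1 \<le> i" "i < j" "j \<le> n"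
  shows "edge_idx n i j \<in> {1..n choose 2}"
proof -
  have "1 \<le> edge_idx n i j" using assms by (simp add: edge_idx_def)
  moreover have "edge_idx n i j \<le> n choose 2" using edge_idx_complement[OF assms] by linarith
  ultimately show ?thesis by simp
qed

section \<open>Factorization of the isolated cut weights\<close>

text \<open>As \<open>i < j\<close>, the string separates the endpoints only if
  \<open>i \<le> k < j\<close>. The image of a rectangle is the form needed for reindexing the
  weight sum.\<close>

lemma isolated_cut_alt:
  assumes "k \<le> n"
  shows "isolated_cut n k p =
    (if p \<in> (\<lambda>(i, j). edge_idx n i j) ` ({1..k} \<times> {k+1..n}) then 1 else 0)"
proof -
  have nth: "(replicate k True @ replicate (n - k) False) ! (i - 1) \<longleftrightarrow> i \<le> k"
    if "1 \<le> i" "i \<le> n" for i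
    using that assms by (auto simp: nth_append)
  have "(\<exists>i j. 1 \<le> i \<and> i < j \<and> j \<le> n \<and> p = edge_idx n i j
               \<and> (replicate k True @ replicate (n - k) False) ! (i - 1)
                 \<noteq> (replicate k True @ replicate (n - k) False) ! (j - 1)) \<longleftrightarrow>
        (\<exists>i j. 1 \<le> i \<and> i \<le> k \<and> k < j \<and> j \<le> n \<and> p = edge_idx n i j)" (is "?L = ?R")
  proof
    assume ?L
    then obtain i j where "1 \<le> i" "i < j" "j \<le> n" "p = edge_idx n i j"
      "(i \<le> k) \<noteq> (j \<le> k)"
      using nth by (metis less_imp_le order_trans)
    then show ?R by (intro exI[of _ i] exI[of _ j]) auto
  next
    assume ?R
    then obtain i j where ij: "1 \<le> i" "i \<le> k" "k < j" "j \<le> n" "p = edge_idx n i j" by blast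
    then show ?L using nth[of i] nth[of j] by (intro exI[of _ i] exI[of _ j]) auto
  qed
  moreover have "p \<in> (\<lambda>(i, j). edge_idx n i j) ` ({1..k} \<times> {k+1..n}) \<longleftrightarrow> ?R"
    by (auto simp: image_iff Bex_def Suc_le_eq)
  moreover have "length (replicate k True @ replicate (n - k) False) = n" using assms by simp
  ultimately show ?thesis
    unfolding isolated_cut_def cut_vector_def by presburger
qed

definition head_sum :: "nat \<Rightarrow> nat \<Rightarrow> real \<Rightarrow> real" where
  "head_sum n k r = (\<Sum>i = 1..k. r ^ ((n - i) choose 2))"

text \<open>Not the closed form \<open>(r ^ m - 1) / (r - 1)\<close>, since the value at
  \<open>r = 1\<close> is needed too.\<close>

definition geo_sum :: "nat \<Rightarrow> real \<Rightarrow> real" where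
  "geo_sum m r = (\<Sum>l<m. r ^ l)"

lemma geo_sum_Suc: "geo_sum (Suc m) r = geo_sum m r + r ^ m"
  by (simp add: geo_sum_def)

lemma geo_sum_pos: "0 < r \<Longrightarrow> 0 < m \<Longrightarrow> 0 < geo_sum m r"
  unfolding geo_sum_def by (intro sum_pos) auto

lemma head_sum_Suc: "head_sum n (Suc k) r = head_sum n k r + r ^ ((n - Suc k) choose 2)"
  by (simp add: head_sum_def)

text \<open>The exponent of an edge splits into a part in \<open>i\<close> and a part in
  \<open>j\<close>, so the sum over the rectangle of cut edges factors.\<close>

lemma cut_weight_isolated_cut:
  assumes "k \<le> n"
  shows "cut_weight n (isolated_cut n k) r = head_sum n k r * geo_sum (n - k) r"
proof -
  define f where "f = (\<lambda>(i, j). edge_idx n i j)"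
  define E where "E = {1..k} \<times> {k+1..n}"
  have inj: "inj_on f E"
    unfolding f_def E_def by (auto simp: inj_on_def dest!: edge_idx_inj[rotated -1])
  have sub: "f ` E \<subseteq> {1..n choose 2}"
  proof
    fix p assume "p \<in> f ` E"
    then obtain i j where "i \<in> {1..k}" "j \<in> {k+1..n}" "p = edge_idx n i j"
      by (auto simp: f_def E_def)
    then show "p \<in> {1..n choose 2}" using edge_idx_bounds[of i j n] by simp
  qed
  have "cut_weight n (isolated_cut n k) r =
      (\<Sum>p = 1..n choose 2. if p \<in> f ` E then r ^ ((n choose 2) - p) else 0)"
    unfolding cut_weight_def isolated_cut_alt[OF assms] f_def E_def
    by (intro sum.cong) auto
  also have "\<dots> = (\<Sum>p \<in> f ` E. r ^ ((n choose 2) - p))"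
    using sub by (subst sum.inter_restrict[symmetric]) (auto simp: Int_absorb1)
  also have "\<dots> = (\<Sum>e \<in> E. r ^ ((n choose 2) - f e))"
    by (subst sum.reindex[OF inj]) simp
  also have "\<dots> = (\<Sum>(i, j) \<in> E. r ^ ((n - i) choose 2) * r ^ (n - j))"
  proof (intro sum.cong refl, clarify)
    fix i j assume "(i, j) \<in> E"
    then have "edge_idx n i j + (((n - i) choose 2) + (n - j)) = n choose 2"
      by (intro edge_idx_complement) (auto simp: E_def)
    then have "(n choose 2) - f (i, j) = ((n - i) choose 2) + (n - j)" by (simp add: f_def)
    then show "r ^ ((n choose 2) - f (i, j)) = r ^ ((n - i) choose 2) * r ^ (n - j)"
      by (simp add: power_add)
  qed
  also have "\<dots> = head_sum n k r * (\<Sum>j = k+1..n. r ^ (n - j))"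
    unfolding E_def head_sum_def sum_product by (simp add: sum.cartesian_product)
  also have "(\<Sum>j = k+1..n. r ^ (n - j)) = geo_sum (n - k) r"
    unfolding geo_sum_def
    by (rule sum.reindex_bij_witness[of _ "\<lambda>l. n - l" "\<lambda>j. n - j"]) auto
  finally show ?thesis .
qed

section \<open>Signs of the threshold polynomials\<close>

text \<open>The common product of \<open>head_sum n k r\<close> and \<open>geo_sum m r\<close>
  cancels from the two factored weights.\<close>

lemma threshold_poly_alt:
  assumes "n = k + Suc m"
  shows "threshold_poly n k r = head_sum n k r * r ^ m - r ^ (m choose 2) * geo_sum m r"
proof -
  have "n - k = Suc m" "n - Suc k = m" using assms by auto
  then show ?thesis
    using assms unfolding threshold_poly_def
    by (simp add: cut_weight_isolated_cut geo_sum_Suc head_sum_Suc algebra_simps)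
qed

text \<open>Let \<open>s = t * r\<close>. Passing from \<open>r\<close> to \<open>s\<close>
  multiplies the positive term by at least \<open>t ^ ((Suc m choose 2) + m)\<close> and the
  negative one by at most \<open>t ^ (Suc m choose 2)\<close>.\<close>

lemma threshold_poly_sign_mono:
  assumes "0 < r" "r < s" "k + 1 < n" "0 \<le> threshold_poly n k r"
  shows "0 < threshold_poly n k s"
proof -
  obtain m where m: "n = k + Suc m" "0 < m"
    using assms(3) by (metis less_imp_Suc_add Suc_eq_plus1 add_Suc_right add_Suc zero_less_Suc)
  define t where "t = s / r"
  have t: "1 < t" "s = t * r" using assms by (auto simp: t_def)
  have A: "t ^ (Suc m choose 2) * head_sum n k r \<le> head_sum n k s"
    unfolding head_sum_def sum_distrib_left
  proof (intro sum_mono)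
    fix i assume "i \<in> {1..k}"
    then have "Suc m choose 2 \<le> (n - i) choose 2" using m by (intro binomial_right_mono) auto
    then have "t ^ (Suc m choose 2) \<le> t ^ ((n - i) choose 2)"
      using t by (intro power_increasing) auto
    then show "t ^ (Suc m choose 2) * r ^ ((n - i) choose 2) \<le> s ^ ((n - i) choose 2)"
      using assms t by (simp add: power_mult_distrib)
  qed
  have S: "geo_sum m s \<le> t ^ m * geo_sum m r"
    unfolding geo_sum_def sum_distrib_left
  proof (intro sum_mono)
    fix l assume "l \<in> {..<m}"
    then have "t ^ l \<le> t ^ m" using t by (intro power_increasing) auto
    then show "s ^ l \<le> t ^ m * r ^ l" using assms t by (simp add: power_mult_distrib)
  qed
  have "s ^ (m choose 2) * geo_sum m s \<le> s ^ (m choose 2) * (t ^ m * geo_sum m r)"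
    using S assms by (intro mult_left_mono) auto
  also have "\<dots> = t ^ (Suc m choose 2) * (r ^ (m choose 2) * geo_sum m r)"
    by (simp add: choose_two_Suc t power_mult_distrib power_add mult_ac)
  also have "\<dots> < t ^ ((Suc m choose 2) + m) * (r ^ (m choose 2) * geo_sum m r)"
  proof (rule mult_strict_right_mono)
    show "t ^ (Suc m choose 2) < t ^ ((Suc m choose 2) + m)"
      using t m(2) by (intro power_strict_increasing) simp_all
    show "0 < r ^ (m choose 2) * geo_sum m r" using assms(1) m(2) geo_sum_pos by simp
  qed
  also have "\<dots> \<le> t ^ ((Suc m choose 2) + m) * (head_sum n k r * r ^ m)"
    using assms t by (intro mult_left_mono) (auto simp: threshold_poly_alt[OF m(1)])
  also have "\<dots> = (t ^ (Suc m choose 2) * head_sum n k r) * s ^ m"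
    by (simp add: t power_mult_distrib power_add mult_ac)
  also have "\<dots> \<le> head_sum n k s * s ^ m"
    using A assms by (intro mult_right_mono) auto
  finally show ?thesis by (simp add: threshold_poly_alt[OF m(1)])
qed

text \<open>Adding \<open>r ^ ?c * r ^ Suc m\<close> to both sides of
  \<open>P\<^sub>k(r) \<ge> 0\<close>, written as an inequality of its two terms, turns them into
  \<open>r\<close> times the positive term of the next polynomial and
  \<open>r ^ ?c * geo_sum (Suc (Suc m)) r\<close>. The latter exceeds \<open>r\<close> times the
  next negative term.\<close>

lemma threshold_poly_Suc_pos:
  assumes "1 < r" "k + 2 < n" "0 \<le> threshold_poly n k r"
  shows "0 < threshold_poly n (Suc k) r"
proof -
  obtain m where m: "n = k + Suc (Suc m)" "0 < m"
    using assms(2) by (metis less_imp_Suc_add Suc_eq_plus1 add_Suc_right add_Suc zero_less_Suc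
        add_2_eq_Suc')
  let ?c = "Suc m choose 2"
  have c: "?c = (m choose 2) + m" by (rule choose_two_Suc)
  have m2: "n = Suc k + Suc m" using m by simp
  have "r * (r ^ (m choose 2) * geo_sum m r) = r ^ Suc (m choose 2) * geo_sum m r" by simp
  also have "\<dots> \<le> r ^ ?c * geo_sum m r"
    using assms m geo_sum_pos[of r m] unfolding c
    by (intro mult_right_mono power_increasing) auto
  also have "\<dots> < r ^ ?c * geo_sum (Suc (Suc m)) r"
    using assms by (intro mult_strict_left_mono) (auto simp: geo_sum_Suc add_pos_pos)
  also have "\<dots> = r ^ ?c * geo_sum (Suc m) r + r ^ ?c * r ^ Suc m"
    by (simp add: geo_sum_Suc algebra_simps)
  also have "\<dots> \<le> head_sum n k r * r ^ Suc m + r ^ ?c * r ^ Suc m"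
    using assms(3) by (simp add: threshold_poly_alt[OF m(1)])
  also have "\<dots> = r * (head_sum n (Suc k) r * r ^ m)"
    using m by (simp add: head_sum_Suc algebra_simps)
  finally have "r ^ (m choose 2) * geo_sum m r < head_sum n (Suc k) r * r ^ m"
    using assms by simp
  then show ?thesis by (simp add: threshold_poly_alt[OF m2])
qed

section \<open>The thresholds as roots\<close>

text \<open>At 1 the value is \<open>k - m < 0\<close>. At 2 the summand \<open>i = k\<close> of
  \<open>head_sum\<close> alone outweighs the negative term, because
  \<open>geo_sum m 2 < 2 ^ m\<close>.\<close>

lemma threshold_poly_root_exists:
  assumes "1 \<le> k" "2 * k + 1 < n"
  shows "\<exists>x. 1 < x \<and> x < 2 \<and> threshold_poly n k x = 0"
proof -
  obtain m where m: "n = k + Suc m" "k < m"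
    using assms by (intro that[of "n - k - 1"]) auto
  have neg: "threshold_poly n k 1 < 0"
    unfolding threshold_poly_alt[OF m(1)] using m(2) by (simp add: head_sum_def geo_sum_def)
  have geo2: "geo_sum m 2 < 2 ^ m" for m
    by (induction m) (simp_all add: geo_sum_def)
  have "(2::real) ^ (m choose 2) * geo_sum m 2 < 2 ^ (m choose 2) * 2 ^ m"
    using geo2 by simp
  also have "\<dots> = 2 ^ (Suc m choose 2)" by (simp add: choose_two_Suc power_add)
  also have "\<dots> \<le> 2 ^ ((n - k) choose 2) * 2 ^ m" using m by simp
  also have "\<dots> \<le> head_sum n k 2 * 2 ^ m"
    unfolding head_sum_def using assms
    by (intro mult_right_mono member_le_sum[of k "{1..k}" "\<lambda>i. 2 ^ ((n - i) choose 2)"]) auto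
  finally have pos: "0 < threshold_poly n k 2" by (simp add: threshold_poly_alt[OF m(1)])
  have "continuous_on {1..2} (threshold_poly n k)"
    unfolding threshold_poly_def cut_weight_def by (intro continuous_intros)
  then obtain x where "1 \<le> x" "x \<le> 2" "threshold_poly n k x = 0"
    using IVT'[of "threshold_poly n k" 1 0 2] neg pos by auto
  then show ?thesis using neg pos by (metis less_irrefl order_le_less)
qed

text \<open>Of two distinct roots the larger would have a positive value by
  \<open>threshold_poly_sign_mono\<close>, so the description in \<open>threshold\<close> denotes
  the root.\<close>

lemma threshold_root:
  assumes "1 \<le> k" "k < n div 2"
  shows "1 < threshold n k" "threshold_poly n k (threshold n k) = 0"
proof -
  let ?R = "\<lambda>x. 1 < x \<and> x < 2 \<and> threshold_poly n k x = 0"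
  obtain x where x: "?R x" using threshold_poly_root_exists[of k n] assms by fastforce
  have k: "k + 1 < n" using assms by linarith
  have unique: "y = x" if y: "?R y" for y
  proof (cases x y rule: linorder_cases)
    case less
    then show ?thesis using threshold_poly_sign_mono[of x y k n] k x y by simp
  next
    case greater
    then show ?thesis using threshold_poly_sign_mono[of y x k n] k x y by simp
  qed simp
  have "(THE y. ?R y) = x" using x unique by (rule the_equality)
  then have "threshold n k = x"
    using assms unfolding threshold_def by simp
  then show "1 < threshold n k" "threshold_poly n k (threshold n k) = 0" using x by auto
qed

section \<open>Comparison of all isolated cuts\<close>

theorem mainTheorem1:
  fixes n k :: nat and r :: real
  assumes "n \<ge> 6" and "1 \<le> k" and "k \<le> n div 2"
    and "r \<in> {threshold n k <..< threshold n (k - 1)}"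
  shows "\<forall>j \<in> {1..n div 2}.
    cut_weight n (isolated_cut n k) r \<ge> cut_weight n (isolated_cut n j) r"
proof
  let ?W = "\<lambda>j. cut_weight n (isolated_cut n j) r"
  fix j assume j: "j \<in> {1..n div 2}"
  \<comment> \<open>For \<open>k = n div 2\<close> the lower end of the interval is the conventional
    value 1, otherwise a root above 1.\<close>
  have r: "1 < r"
  proof (cases "k = n div 2")
    case True
    then show ?thesis using assms by (auto simp: threshold_def)
  next
    case False
    then show ?thesis using assms threshold_root(1)[of k n] by auto
  qed
  \<comment> \<open>\<open>r\<close> lies to the right of the root for \<open>k\<close>, and
    positivity passes on to larger indices.\<close>
  have up: "0 < threshold_poly n i r" if "k \<le> i" "i < n div 2" for i
    using that
  proof (induction i rule: dec_induct)
    case base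
    then show ?case
      using threshold_root[of k n] threshold_poly_sign_mono[of "threshold n k" r k n] assms by auto
  next
    case (step i)
    then show ?case using r by (intro threshold_poly_Suc_pos) auto
  qed
  \<comment> \<open>Otherwise nonnegativity at \<open>r\<close> would pass on up to index
    \<open>k - 1\<close>, forcing a positive value at the root \<open>threshold n (k - 1)\<close>,
    which lies to the right of \<open>r\<close>. It is a genuine root, as
    \<open>1 \<le> i < k\<close> gives \<open>k \<ge> 2\<close>.\<close>
  have down: "threshold_poly n i r < 0" if "1 \<le> i" "i < k" for i
  proof (rule ccontr)
    assume "\<not> threshold_poly n i r < 0"
    then have i: "0 \<le> threshold_poly n i r" by simp
    have "0 \<le> threshold_poly n l r" if "i \<le> l" "l < k" for l
      using that
    proof (induction l rule: dec_induct)
      case base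
      show ?case by (rule i)
    next
      case (step l)
      then show ?case using r assms by (intro less_imp_le[OF threshold_poly_Suc_pos]) auto
    qed
    then have "0 \<le> threshold_poly n (k - 1) r" using that by simp
    then have "0 < threshold_poly n (k - 1) (threshold n (k - 1))"
      using assms r that by (intro threshold_poly_sign_mono[of r]) auto
    moreover have "1 \<le> k - 1" "k - 1 < n div 2" using that assms(2,3) by linarith+
    ultimately show False using threshold_root(2)[of "k - 1" n] by simp
  qed
  \<comment> \<open>\<open>threshold_poly n l r\<close> is \<open>?W l - ?W (l + 1)\<close>, so its
    sign compares neighbours on the way between \<open>j\<close> and \<open>k\<close>.\<close>
  show "?W j \<le> ?W k"
  proof (cases "k \<le> j")
    case True
    then show ?thesis using j
    proof (induction j rule: dec_induct)
      case (step l)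
      then show ?case using up[of l] assms by (auto simp: threshold_poly_def)
    qed simp
  next
    case False
    then have "j \<le> k" by simp
    then show ?thesis using j
    proof (induction j rule: inc_induct)
      case (step l)
      then show ?case using down[of l] assms by (auto simp: threshold_poly_def)
    qed simp
  qed
qed

end
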